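(* Let $R$ be a t-fine ring. Then, for every integer $n\geq 1$, the matrix ring ${\rm M}_n(R)$ is t-fine.
   Context: Rings are associative with identity, not necessarily commutative. A ring $R$ is t-fine if every non-zero element $a\in R$ can be written as $a=u+b$, where $u$ is a unit of $R$ of finite multiplicative order and $b$ is a nilpotent element of $R$ (no commutation required). ${\rm M}_n(R)$ is the ring of all $n\times n$ matrices over $R$. *)

theory Defs
  imports "Jordan_Normal_Form.Matrix"
begin

definition finite_order_unit :: "('a, 'm) ring_scheme \<Rightarrow> 'a \<Rightarrow> bool" where
  "finite_order_unit R u \<longleftrightarrow> u \<in> Units R \<and> (\<exists>k::nat. k > 0 \<and> u [^]\<^bsub>R\<^esub> k = \<one>\<^bsub>R\<^esub>)"

definition nilpotent :: "('a, 'm) ring_scheme \<Rightarrow> 'a \<Rightarrow> bool" where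
  "nilpotent R b \<longleftrightarrow> b \<in> carrier R \<and> (\<exists>k::nat. b [^]\<^bsub>R\<^esub> k = \<zero>\<^bsub>R\<^esub>)"

locale t_fine_ring = ring R for R (structure) +
  assumes t_fine: "\<lbrakk>a \<in> carrier R; a \<noteq> \<zero>\<rbrakk>
    \<Longrightarrow> \<exists>u b. finite_order_unit R u \<and> nilpotent R b \<and> a = u \<oplus> b"

text \<open>
  The library's \<open>ring_mat\<close> takes its entries from a type-class semiring.  The version below has
  entries in the carrier of an arbitrary ring record; it uses the type of matrices only as a
  container, and all operations are computed from those of \<open>R\<close>.
\<close>

definition matrix_ring :: "nat \<Rightarrow> ('a, 'm) ring_scheme \<Rightarrow> 'a mat ring" where
  "matrix_ring n R = \<lparr>
     carrier = {A \<in> carrier_mat n n. \<forall>i<n. \<forall>j<n. A $$ (i, j) \<in> carrier R},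
     mult = (\<lambda>A B. mat n n (\<lambda>(i, j). \<Oplus>\<^bsub>R\<^esub>k\<in>{..<n}. A $$ (i, k) \<otimes>\<^bsub>R\<^esub> B $$ (k, j))),
     one = mat n n (\<lambda>(i, j). if i = j then \<one>\<^bsub>R\<^esub> else \<zero>\<^bsub>R\<^esub>),
     zero = mat n n (\<lambda>(i, j). \<zero>\<^bsub>R\<^esub>),
     add = (\<lambda>A B. mat n n (\<lambda>(i, j). A $$ (i, j) \<oplus>\<^bsub>R\<^esub> B $$ (i, j)))\<rparr>"

end

theory Submission
  imports Defs
begin

text \<open>
  Write \<open>1 = e + f\<close> with orthogonal idempotents whose corners \<open>eSe\<close> and \<open>fSf\<close> are t-fine. If
  both diagonal blocks of \<open>a\<close> are non-zero, decompose them as \<open>u + b\<close> and \<open>u' + b'\<close>; then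
  \<open>a = (u + u' + eaf) + (b + b' + fae)\<close> is a sum of two triangular elements, the second
  nilpotent. Some power of the first is \<open>1 + h\<close> with \<open>h \<in> eSf\<close>, which has finite order because a
  t-fine ring has positive characteristic: if \<open>2 = u + b\<close> with \<open>u\<^sup>m = 1\<close> and \<open>bv = 0\<close>, then
  \<open>(2\<^sup>m - 1)v = 0\<close>, and the annihilator of an integer is an ideal of a
  simple ring.

  Otherwise conjugate \<open>a\<close> by \<open>1 + h\<close> with \<open>h\<close> in \<open>eSf\<close> or \<open>fSe\<close>. Since \<open>S\<close> is prime,
  this reaches the first case, except when \<open>S\<close> is the ring of \<open>2 \<times> 2\<close> matrices over the field with
  two elements. For matrix rings, induct on the size of the set of diagonal positions.
\<close>

section \<open>Finite-order units and t-clean elements\<close>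

lemma (in ring) finite_order_unitI:
  assumes "u \<in> carrier R" and "0 < (m::nat)" and "u [^] m = \<one>"
  shows "finite_order_unit R u"
proof -
  obtain i where m: "m = Suc i" using assms(2) gr0_conv_Suc by blast
  have "u [^] i \<otimes> u = \<one>" "u \<otimes> u [^] i = \<one>"
    using assms m nat_pow_Suc2[OF assms(1), of i] by auto
  then have "u \<in> Units R" using assms(1) unfolding Units_def by blast
  then show ?thesis using assms by (auto simp: finite_order_unit_def)
qed

text \<open>The t-fine condition for a single element, because the argument repeatedly trades an
  element for a conjugate or for one of its blocks.\<close>

definition t_clean :: "('a, 'm) ring_scheme \<Rightarrow> 'a \<Rightarrow> bool" where
  "t_clean R a \<longleftrightarrow> (\<exists>u b. finite_order_unit R u \<and> nilpotent R b \<and> a = u \<oplus>\<^bsub>R\<^esub> b)"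

lemma t_fine_ring_iff:
  "t_fine_ring R \<longleftrightarrow> ring R \<and> (\<forall>a\<in>carrier R. a \<noteq> \<zero>\<^bsub>R\<^esub> \<longrightarrow> t_clean R a)"
  unfolding t_fine_ring_def t_fine_ring_axioms_def t_clean_def by blast

context ring begin

lemma t_cleanE:
  assumes "t_clean R a"
  obtains u b m k where "u \<in> carrier R" "u \<in> Units R" "b \<in> carrier R" "0 < (m::nat)" "u [^] m = \<one>"
    "b [^] (k::nat) = \<zero>" "a = u \<oplus> b"
  using assms unfolding t_clean_def finite_order_unit_def nilpotent_def
  by (metis Units_closed)

lemma t_cleanI:
  assumes "u \<in> carrier R" "b \<in> carrier R" "0 < (m::nat)" "u [^] m = \<one>" "b [^] (k::nat) = \<zero>" "a = u \<oplus> b"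
  shows "t_clean R a"
  unfolding t_clean_def nilpotent_def using assms finite_order_unitI[of u m] by metis

lemma pow_conj:
  assumes "x \<in> carrier R" "p \<in> carrier R" "q \<in> carrier R" "p \<otimes> q = \<one>" "q \<otimes> p = \<one>"
  shows "(q \<otimes> x \<otimes> p) [^] (m::nat) = q \<otimes> x [^] m \<otimes> p"
proof (induction m)
  case (Suc m)
  have "q \<otimes> x [^] m \<otimes> p \<otimes> (q \<otimes> x \<otimes> p) = q \<otimes> x [^] m \<otimes> (p \<otimes> q) \<otimes> x \<otimes> p"
    using assms(1-3) by (simp add: m_assoc)
  then show ?case using Suc assms by (simp add: m_assoc)
qed (use assms in simp)

text \<open>Powers commute with conjugation, so conjugating both summands back by \<open>q\<close>
  and \<open>p\<close> keeps the exponents \<open>m\<close> and \<open>k\<close>.\<close>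

lemma t_clean_conj:
  assumes a: "a \<in> carrier R" and p: "p \<in> carrier R" and q: "q \<in> carrier R"
    and pq: "p \<otimes> q = \<one>" and qp: "q \<otimes> p = \<one>"
    and tc: "t_clean R (p \<otimes> a \<otimes> q)"
  shows "t_clean R a"
  using tc
proof (rule t_cleanE)
  fix u b and m k :: nat
  assume u: "u \<in> carrier R" "0 < m" "u [^] m = \<one>" and b: "b \<in> carrier R" "b [^] k = \<zero>"
    and eq: "p \<otimes> a \<otimes> q = u \<oplus> b"
  have "a = (q \<otimes> p) \<otimes> a \<otimes> (q \<otimes> p)" using a qp by simp
  also have "\<dots> = q \<otimes> (p \<otimes> a \<otimes> q) \<otimes> p" using a p q by (simp add: m_assoc)
  also have "\<dots> = q \<otimes> u \<otimes> p \<oplus> q \<otimes> b \<otimes> p" using u b p q by (simp add: eq l_distr r_distr)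
  finally have "a = q \<otimes> u \<otimes> p \<oplus> q \<otimes> b \<otimes> p" .
  then show ?thesis using u b p q pq qp
    by (intro t_cleanI[of "q \<otimes> u \<otimes> p" "q \<otimes> b \<otimes> p" m k]) (simp_all add: pow_conj)
qed

end

section \<open>Ideals, primeness and characteristic of t-fine rings\<close>

context t_fine_ring begin

text \<open>If \<open>a = u + b\<close> lies in the ideal, then \<open>u b\<^sup>i = a b\<^sup>i - b\<^sup>i\<^sup>+\<^sup>1\<close> brings \<open>b\<^sup>i\<close>
  into the ideal as soon as \<open>b\<^sup>i\<^sup>+\<^sup>1\<close> is there.\<close>

lemma one_in_ideal:
  assumes J: "J \<subseteq> carrier R"
    and minus: "\<And>x y. x \<in> J \<Longrightarrow> y \<in> J \<Longrightarrow> x \<ominus> y \<in> J"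
    and lm: "\<And>s x. s \<in> carrier R \<Longrightarrow> x \<in> J \<Longrightarrow> s \<otimes> x \<in> J"
    and rm: "\<And>s x. s \<in> carrier R \<Longrightarrow> x \<in> J \<Longrightarrow> x \<otimes> s \<in> J"
    and a: "a \<in> J" "a \<noteq> \<zero>"
  shows "\<one> \<in> J"
proof -
  have "t_clean R a" using a J t_fine unfolding t_clean_def by blast
  then obtain u b m k where u: "u \<in> carrier R" "u \<in> Units R" and b: "b \<in> carrier R"
      "b [^] (k::nat) = \<zero>" and eq: "a = u \<oplus> b"
    by (rule t_cleanE) blast
  have step: "b [^] i \<in> J" if "b [^] Suc i \<in> J" for i :: nat
  proof -
    have "a \<otimes> b [^] i \<ominus> b [^] Suc i = u \<otimes> b [^] i \<oplus> b \<otimes> b [^] i \<ominus> b \<otimes> b [^] i"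
      using u b nat_pow_Suc2[OF b(1), of i] by (simp add: eq l_distr)
    also have "\<dots> = u \<otimes> b [^] i" using u b by (simp add: minus_eq a_assoc r_neg)
    finally have "u \<otimes> b [^] i \<in> J" using minus rm that a b by (metis nat_pow_closed)
    then have "inv u \<otimes> (u \<otimes> b [^] i) \<in> J" using lm u by simp
    then show ?thesis using u b by (simp add: m_assoc[symmetric])
  qed
  \<comment> \<open>Downward induction on the exponent: it starts at
    \<open>b [^] k = \<zero>\<close> and arrives at \<open>b [^] 0 = \<one>\<close> when
    \<open>i = k\<close>.\<close>
  have "b [^] (k - i) \<in> J" for i
  proof (induction i)
    case 0
    have "\<zero> = a \<ominus> a" using a J by (auto simp: minus_eq r_neg)
    then show ?case using b minus a by simp
  next
    case (Suc i)
    show ?case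
    proof (cases "i < k")
      case True
      then have "k - i = Suc (k - Suc i)" by simp
      then show ?thesis using Suc step by metis
    qed (use Suc in simp)
  qed
  from this[of k] show ?thesis by simp
qed

text \<open>For fixed \<open>p\<close>, the elements \<open>z\<close> with \<open>pRz = 0\<close>
  form a two-sided ideal. Once it contains a non-zero \<open>q\<close>, it contains
  \<open>\<one>\<close>.\<close>

lemma prime:
  assumes p: "p \<in> carrier R" and q: "q \<in> carrier R" "q \<noteq> \<zero>"
    and pq: "\<And>s. s \<in> carrier R \<Longrightarrow> p \<otimes> s \<otimes> q = \<zero>"
  shows "p = \<zero>"
proof -
  define J where "J = {z \<in> carrier R. \<forall>s\<in>carrier R. p \<otimes> s \<otimes> z = \<zero>}"
  have "\<one> \<in> J"
  proof (rule one_in_ideal[of J q])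
    show "s \<otimes> x \<in> J" if "s \<in> carrier R" "x \<in> J" for s x
    proof -
      have "p \<otimes> r \<otimes> (s \<otimes> x) = p \<otimes> (r \<otimes> s) \<otimes> x" if "r \<in> carrier R" for r
        using p \<open>s \<in> carrier R\<close> \<open>x \<in> J\<close> that by (simp add: J_def m_assoc)
      then show ?thesis using that by (simp add: J_def)
    qed
    show "x \<otimes> s \<in> J" if "s \<in> carrier R" "x \<in> J" for s x
    proof -
      have "p \<otimes> r \<otimes> (x \<otimes> s) = p \<otimes> r \<otimes> x \<otimes> s" if "r \<in> carrier R" for r
        using p \<open>s \<in> carrier R\<close> \<open>x \<in> J\<close> that by (simp add: J_def m_assoc)
      then show ?thesis using that by (simp add: J_def)
    qed
  qed (use p q pq in \<open>auto simp: J_def minus_eq r_distr r_minus\<close>)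
  then have "p \<otimes> \<one> \<otimes> \<one> = \<zero>" unfolding J_def by blast
  then show ?thesis using p by simp
qed

lemma char_pos: "\<exists>N::nat. 0 < N \<and> [N] \<cdot> \<one> = \<zero>"
proof (cases "\<one> \<oplus> \<one> = \<zero>")
  \<comment> \<open>Here the t-fine condition says nothing about
    \<open>\<one> \<oplus> \<one>\<close>, but \<open>N = 2\<close> works directly.\<close>
  case True
  then have "[(2::nat)] \<cdot> \<one> = \<zero>" by (simp add: numeral_2_eq_2)
  then show ?thesis by (intro exI[of _ 2]) simp
next
  case False
  then have nt: "\<one> \<noteq> \<zero>" by auto
  have "t_clean R (\<one> \<oplus> \<one>)" using False t_fine unfolding t_clean_def by simp
  then obtain u b m k where u: "u \<in> carrier R" "0 < m" "u [^] (m::nat) = \<one>" and b: "b \<in> carrier R"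
      "b [^] (k::nat) = \<zero>" and eq: "\<one> \<oplus> \<one> = u \<oplus> b"
    by (rule t_cleanE) blast
  \<comment> \<open>Minimality of \<open>j\<close> makes the preceding power \<open>v\<close> of
    \<open>b\<close> non-zero, while \<open>b\<close> kills it. Hence \<open>u\<close> acts on
    \<open>v\<close> as doubling.\<close>
  define j where "j = (LEAST k::nat. b [^] k = \<zero>)"
  have j: "b [^] j = \<zero>" unfolding j_def using b(2) by (rule LeastI)
  then obtain i where ji: "j = Suc i" using nt by (cases j) auto
  define v where "v = b [^] i"
  have v: "v \<in> carrier R" "v \<noteq> \<zero>" "b \<otimes> v = \<zero>"
    using b j ji not_less_Least[of i "\<lambda>k. b [^] k = \<zero>"] nat_pow_Suc2[OF b(1), of i]
    unfolding v_def j_def[symmetric] by auto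
  have "u \<otimes> v = (u \<oplus> b) \<otimes> v" using u b v by (simp add: l_distr)
  then have uv: "u \<otimes> v = v \<oplus> v" using v by (simp add: eq[symmetric] l_distr)
  have "u [^] i \<otimes> v = [((2::nat) ^ i)] \<cdot> v" for i :: nat
  proof (induction i)
    case (Suc i)
    have "u [^] Suc i \<otimes> v = u [^] i \<otimes> v \<oplus> u [^] i \<otimes> v"
      using u v by (simp add: m_assoc uv r_distr)
    also have "\<dots> = [((2::nat) ^ i + 2 ^ i)] \<cdot> v" using v by (simp add: Suc add.nat_pow_mult)
    finally show ?case by (simp add: mult_2)
  qed (use v in simp)
  from this[of m] have "[((2::nat) ^ m)] \<cdot> v = v" using u v by simp
  moreover have "(2::nat) ^ m = Suc (2 ^ m - 1)" by simp
  ultimately have "[((2::nat) ^ m - 1)] \<cdot> v \<oplus> v = v"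
    by (metis add.nat_pow_Suc)
  then have Nv: "[((2::nat) ^ m - 1)] \<cdot> v = \<zero>" using v by simp
  define N :: nat where "N = 2 ^ m - 1"
  have "0 < N" using one_less_power[of "2::nat" m] u by (simp add: N_def)
  moreover have "\<one> \<in> {z \<in> carrier R. [N] \<cdot> z = \<zero>}"
  proof (rule one_in_ideal[of _ v])
    fix s x assume s: "s \<in> carrier R" and x: "x \<in> {z \<in> carrier R. [N] \<cdot> z = \<zero>}"
    show "s \<otimes> x \<in> {z \<in> carrier R. [N] \<cdot> z = \<zero>}"
      using s x add_pow_rdistr[of s x N] by simp
    show "x \<otimes> s \<in> {z \<in> carrier R. [N] \<cdot> z = \<zero>}"
      using s x add_pow_ldistr[of x s N] by simp
  qed (use v Nv in \<open>auto simp: N_def minus_eq add.nat_pow_distrib add.nat_pow_inv\<close>)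
  ultimately show ?thesis by blast
qed

end

text \<open>A non-zero element of \<open>S\<close> has a preimage, again non-zero, and
  \<open>h\<close> maps a decomposition of the preimage to one of the element. This transports
  t-fineness from \<open>R\<close> to the corner of the matrix ring at one diagonal
  position.\<close>

lemma t_fine_ring_hom_image:
  fixes R :: "('a, 'm) ring_scheme" and S :: "('b, 'n) ring_scheme" and h :: "'a \<Rightarrow> 'b"
  assumes R: "t_fine_ring R" and S: "ring S" and h: "h \<in> ring_hom R S" "h ` carrier R = carrier S"
  shows "t_fine_ring S"
proof -
  interpret R: t_fine_ring R by fact
  interpret S: ring S by fact
  have hc: "h x \<in> carrier S" if "x \<in> carrier R" for x
    using h(1) that by (rule ring_hom_closed)
  have h0: "h \<zero>\<^bsub>R\<^esub> = \<zero>\<^bsub>S\<^esub>" using ring_hom_zero[OF h(1) R.ring_axioms S] .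
  have pow: "h (x [^]\<^bsub>R\<^esub> (m::nat)) = h x [^]\<^bsub>S\<^esub> m" if "x \<in> carrier R" for x m
    by (induction m) (use that h(1) in \<open>simp_all add: ring_hom_one ring_hom_mult\<close>)
  have "t_clean S a" if "a \<in> carrier S" "a \<noteq> \<zero>\<^bsub>S\<^esub>" for a
  proof -
    have "a \<in> h ` carrier R" using h(2) that(1) by simp
    then obtain r where r: "r \<in> carrier R" "a = h r" by blast
    then have "t_clean R r" using that h0 R.t_fine_ring_axioms by (auto simp: t_fine_ring_iff)
    then show ?thesis
    proof (rule R.t_cleanE)
      fix u b and m k :: nat
      assume *: "u \<in> carrier R" "b \<in> carrier R" "0 < m" "u [^]\<^bsub>R\<^esub> m = \<one>\<^bsub>R\<^esub>" "b [^]\<^bsub>R\<^esub> k = \<zero>\<^bsub>R\<^esub>" "r = u \<oplus>\<^bsub>R\<^esub> b"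
      then show ?thesis using r h0 h(1)
        by (intro S.t_cleanI[of "h u" "h b" m k]) (simp_all add: hc pow[symmetric] ring_hom_one ring_hom_add)
    qed
  qed
  then show ?thesis using S by (simp add: t_fine_ring_iff)
qed

subsection \<open>Peirce components and corner rings\<close>

text \<open>For idempotents \<open>e\<close> and \<open>f\<close> this is \<open>eRf\<close>.
  Equations instead of an image make membership directly usable for rewriting.\<close>

definition peirce :: "('a, 'm) ring_scheme \<Rightarrow> 'a \<Rightarrow> 'a \<Rightarrow> 'a set" where
  "peirce R e f = {x \<in> carrier R. e \<otimes>\<^bsub>R\<^esub> x = x \<and> x \<otimes>\<^bsub>R\<^esub> f = x}"

text \<open>The ring \<open>eRe\<close>. Addition, multiplication and zero remain literally those of
  \<open>R\<close>; powers differ at exponent zero, where the corner gives \<open>e\<close>.\<close>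

definition corner :: "('a, 'm) ring_scheme \<Rightarrow> 'a \<Rightarrow> ('a, 'm) ring_scheme" where
  "corner R e = R\<lparr>carrier := peirce R e e, one := e\<rparr>"

lemma corner_sel [simp]:
  "carrier (corner R e) = peirce R e e" "\<one>\<^bsub>corner R e\<^esub> = e" "\<zero>\<^bsub>corner R e\<^esub> = \<zero>\<^bsub>R\<^esub>"
  "x \<otimes>\<^bsub>corner R e\<^esub> y = x \<otimes>\<^bsub>R\<^esub> y" "x \<oplus>\<^bsub>corner R e\<^esub> y = x \<oplus>\<^bsub>R\<^esub> y"
  by (simp_all add: corner_def)

lemma corner_pow [simp]:
  "x [^]\<^bsub>corner R e\<^esub> Suc n = x [^]\<^bsub>corner R e\<^esub> n \<otimes>\<^bsub>R\<^esub> x"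
  "x [^]\<^bsub>corner R e\<^esub> (0::nat) = e"
  by (simp_all add: nat_pow_def)

lemma corner_add_pow: "add_pow (corner R e) (n::nat) x = add_pow R n x"
  unfolding add_pow_def nat_pow_def by simp

context ring begin

lemma peirceD:
  assumes "x \<in> peirce R e f"
  shows "x \<in> carrier R" "e \<otimes> x = x" "x \<otimes> f = x"
  using assms by (simp_all add: peirce_def)

lemma peirce_mult:
  assumes "x \<in> peirce R e f" "y \<in> peirce R f' g" "e \<in> carrier R" "g \<in> carrier R"
  shows "x \<otimes> y \<in> peirce R e g"
  using assms by (simp add: peirce_def m_assoc[symmetric]) (simp add: m_assoc)

lemma peirce_mult_zero:
  assumes "x \<in> peirce R e f" "y \<in> peirce R f' g" "f \<in> carrier R" "f' \<in> carrier R" "f \<otimes> f' = \<zero>"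
  shows "x \<otimes> y = \<zero>"
proof -
  have "x \<otimes> y = x \<otimes> f \<otimes> (f' \<otimes> y)" using assms by (simp add: peirce_def)
  also have "\<dots> = x \<otimes> (f \<otimes> f') \<otimes> y" using assms(1,2)[THEN peirceD(1)] assms(3,4) by (simp add: m_assoc)
  finally show ?thesis using assms(1,2)[THEN peirceD(1)] assms(5) by simp
qed

lemma peirce_add:
  assumes "x \<in> peirce R e f" "y \<in> peirce R e f" "e \<in> carrier R" "f \<in> carrier R"
  shows "x \<oplus> y \<in> peirce R e f"
  using assms by (simp add: peirce_def l_distr r_distr)

lemma peirce_uminus:
  assumes "x \<in> peirce R e f" "e \<in> carrier R" "f \<in> carrier R"
  shows "\<ominus> x \<in> peirce R e f"
  using assms by (simp add: peirce_def l_minus r_minus)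

lemma peirce_minus:
  assumes "x \<in> peirce R e f" "y \<in> peirce R e f" "e \<in> carrier R" "f \<in> carrier R"
  shows "x \<ominus> y \<in> peirce R e f"
  using assms by (simp add: minus_eq peirce_add peirce_uminus)

lemma peirce_zero [simp]:
  assumes "e \<in> carrier R" "f \<in> carrier R"
  shows "\<zero> \<in> peirce R e f"
  using assms by (simp add: peirce_def)

lemma peirce_self:
  assumes "e \<in> carrier R" "e \<otimes> e = e"
  shows "e \<in> peirce R e e"
  using assms by (simp add: peirce_def)

lemma peirce_sandwich:
  assumes "x \<in> carrier R" "e \<in> carrier R" "e \<otimes> e = e" "f \<in> carrier R" "f \<otimes> f = f"
  shows "e \<otimes> x \<otimes> f \<in> peirce R e f"
  using assms by (simp add: peirce_def m_assoc) (simp add: m_assoc[symmetric])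

lemma ring_corner:
  assumes e: "e \<in> carrier R" "e \<otimes> e = e"
  shows "ring (corner R e)"
proof (rule ringI)
  show "abelian_group (corner R e)"
  proof (rule abelian_groupI)
    fix x assume "x \<in> carrier (corner R e)"
    then have "\<ominus> x \<in> carrier (corner R e)" "\<ominus> x \<oplus>\<^bsub>corner R e\<^esub> x = \<zero>\<^bsub>corner R e\<^esub>"
      using e by (auto simp: peirce_uminus l_neg dest: peirceD)
    then show "\<exists>y\<in>carrier (corner R e). y \<oplus>\<^bsub>corner R e\<^esub> x = \<zero>\<^bsub>corner R e\<^esub>" by blast
  qed (use e in \<open>auto simp: peirce_add intro: a_assoc a_comm dest: peirceD\<close>)
  show "monoid (corner R e)"
    by (rule monoidI) (use e in \<open>auto simp: peirce_self intro: m_assoc peirce_mult dest: peirceD\<close>)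
qed (auto intro: l_distr r_distr dest: peirceD)

lemma corner_one: "corner R \<one> = R"
proof -
  have "peirce R \<one> \<one> = carrier R" by (auto simp: peirce_def)
  then show ?thesis by (simp add: corner_def)
qed

text \<open>Since \<open>c\<close> is an identity for \<open>e\<close>, all of \<open>eRe\<close>
  already lies in \<open>cRc\<close>. This identifies the corners met when the decomposition
  argument is run inside \<open>cRc\<close>.\<close>

lemma corner_corner:
  assumes c: "c \<in> carrier R" "e \<in> carrier R" "c \<otimes> e = e" "e \<otimes> c = e"
  shows "corner (corner R c) e = corner R e"
proof -
  have "x \<in> peirce R c c" if "x \<in> peirce R e e" for x
  proof -
    note x = peirceD[OF that]
    have "c \<otimes> x = c \<otimes> e \<otimes> x" using x c(1,2) by (simp add: m_assoc)
    moreover have "x \<otimes> c = x \<otimes> (e \<otimes> c)" using x c(1,2) by (simp add: m_assoc[symmetric])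
    ultimately show ?thesis using x c by (simp add: peirce_def)
  qed
  then have "peirce (corner R c) e e = peirce R e e"
    by (auto simp: peirce_def)
  then show ?thesis by (simp add: corner_def)
qed

end

text \<open>Primeness is carried separately from t-fineness, since for the matrix ring it is
  available before t-fineness is proved.\<close>

locale prime_ring = ring +
  assumes prime: "\<And>p q. p \<in> carrier R \<Longrightarrow> q \<in> carrier R \<Longrightarrow> q \<noteq> \<zero> \<Longrightarrow>
    (\<And>s. s \<in> carrier R \<Longrightarrow> p \<otimes> s \<otimes> q = \<zero>) \<Longrightarrow> p = \<zero>"

text \<open>For \<open>p\<close> and \<open>q\<close> in \<open>eRe\<close>,
  \<open>psq = p(ese)q\<close>, so testing against the corner is the same as testing against
  \<open>R\<close>.\<close>

lemma (in prime_ring) prime_ring_corner: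
  assumes e: "e \<in> carrier R" "e \<otimes> e = e"
  shows "prime_ring (corner R e)"
proof -
  interpret C: ring "corner R e" using e by (rule ring_corner)
  show ?thesis
  proof
    fix p q
    assume p: "p \<in> carrier (corner R e)" and q: "q \<in> carrier (corner R e)" "q \<noteq> \<zero>\<^bsub>corner R e\<^esub>"
      and pq: "\<And>s. s \<in> carrier (corner R e) \<Longrightarrow> p \<otimes>\<^bsub>corner R e\<^esub> s \<otimes>\<^bsub>corner R e\<^esub> q = \<zero>\<^bsub>corner R e\<^esub>"
    have "p \<otimes> s \<otimes> q = \<zero>" if s: "s \<in> carrier R" for s
    proof -
      have pe: "p \<in> carrier R" "p \<otimes> e = p" "q \<in> carrier R" "e \<otimes> q = q"
        using p q by (auto dest: peirceD)
      have "p \<otimes> s \<otimes> q = (p \<otimes> e) \<otimes> s \<otimes> (e \<otimes> q)" using pe by simp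
      also have "\<dots> = p \<otimes> (e \<otimes> s \<otimes> e) \<otimes> q" using pe(1,3) s e(1) by (simp add: m_assoc)
      also have "\<dots> = \<zero>" using pq[of "e \<otimes> s \<otimes> e"] e s by (simp add: peirce_sandwich)
      finally show ?thesis .
    qed
    then show "p = \<zero>\<^bsub>corner R e\<^esub>" using p q prime[of p q] by (auto dest: peirceD)
  qed
qed

section \<open>Triangular elements for a pair of orthogonal idempotents\<close>

locale peirce_decomposition = prime_ring +
  fixes e f
  assumes e: "e \<in> carrier R" "e \<otimes> e = e" "e \<noteq> \<zero>"
    and f: "f \<in> carrier R" "f \<otimes> f = f" "f \<noteq> \<zero>"
    and ef: "e \<otimes> f = \<zero>" and fe: "f \<otimes> e = \<zero>" and e_plus_f: "e \<oplus> f = \<one>"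
    and t_fine_e: "t_fine_ring (corner R e)" and t_fine_f: "t_fine_ring (corner R f)"
begin

text \<open>The hypotheses are symmetric, so each result about the pair \<open>e\<close>,
  \<open>f\<close> also serves with upper and lower blocks exchanged.\<close>

lemma swap: "peirce_decomposition R f e"
  unfolding peirce_decomposition_def peirce_decomposition_axioms_def
  using prime_ring_axioms e f ef fe e_plus_f t_fine_e t_fine_f a_comm[OF f(1) e(1)] by simp

text \<open>The vanishing products of blocks whose inner indices differ; in particular any two
  elements of \<open>eRf\<close> have product zero.\<close>

lemmas peirce_mult_cross = peirce_mult_zero[OF _ _ f(1) e(1) fe] peirce_mult_zero[OF _ _ e(1) f(1) ef]

text \<open>Block upper triangular elements multiply diagonal by diagonal. The corner entry is only
  tracked up to membership in \<open>eRf\<close>, which is enough because \<open>eRf\<close> squares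
  to zero.\<close>

lemma pow_triangular:
  assumes x: "x \<in> peirce R e e" and y: "y \<in> peirce R f f" and h: "h \<in> peirce R e f"
  shows "\<exists>h'\<in>peirce R e f. (x \<oplus> y \<oplus> h) [^] (n::nat)
    = x [^]\<^bsub>corner R e\<^esub> n \<oplus> y [^]\<^bsub>corner R f\<^esub> n \<oplus> h'"
proof (induction n)
  case 0
  show ?case using e f by (intro bexI[of _ \<zero>]) (auto simp: e_plus_f)
next
  case (Suc n)
  then obtain h' where h': "h' \<in> peirce R e f"
    "(x \<oplus> y \<oplus> h) [^] n = x [^]\<^bsub>corner R e\<^esub> n \<oplus> y [^]\<^bsub>corner R f\<^esub> n \<oplus> h'" by blast
  interpret E: t_fine_ring "corner R e" by (rule t_fine_e)
  interpret F: t_fine_ring "corner R f" by (rule t_fine_f)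
  define X where "X = x [^]\<^bsub>corner R e\<^esub> n"
  define Y where "Y = y [^]\<^bsub>corner R f\<^esub> n"
  have X: "X \<in> peirce R e e" using E.nat_pow_closed[of x n] x by (simp add: X_def)
  have Y: "Y \<in> peirce R f f" using F.nat_pow_closed[of y n] y by (simp add: Y_def)
  have z: "X \<otimes> y = \<zero>" "Y \<otimes> x = \<zero>" "Y \<otimes> h = \<zero>" "h' \<otimes> x = \<zero>" "h' \<otimes> h = \<zero>"
    using X Y x y h h' peirce_mult_cross by blast+
  have "(x \<oplus> y \<oplus> h) [^] Suc n = (X \<oplus> Y \<oplus> h') \<otimes> (x \<oplus> y \<oplus> h)"
    using h' by (simp add: X_def Y_def)
  also have "\<dots> = X \<otimes> x \<oplus> Y \<otimes> y \<oplus> (X \<otimes> h \<oplus> h' \<otimes> y)"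
    using X[THEN peirceD(1)] Y[THEN peirceD(1)] x[THEN peirceD(1)] y[THEN peirceD(1)] h[THEN peirceD(1)] h'(1)[THEN peirceD(1)]
    by (simp add: l_distr r_distr z a_ac)
  finally show ?case
    using X Y x y h h' e f
    by (intro bexI[of _ "X \<otimes> h \<oplus> h' \<otimes> y"]) (auto simp: X_def Y_def intro!: peirce_add peirce_mult)
qed

text \<open>The exponent \<open>k + l\<close> kills both diagonal entries at once. What is left lies
  in \<open>eRf\<close>, so doubling the exponent gives zero.\<close>

lemma nilpotent_triangular:
  assumes x: "x \<in> peirce R e e" "x [^]\<^bsub>corner R e\<^esub> (k::nat) = \<zero>"
    and y: "y \<in> peirce R f f" "y [^]\<^bsub>corner R f\<^esub> (l::nat) = \<zero>" and h: "h \<in> peirce R e f"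
  shows "\<exists>n::nat. (x \<oplus> y \<oplus> h) [^] n = \<zero>"
proof -
  interpret E: t_fine_ring "corner R e" by (rule t_fine_e)
  interpret F: t_fine_ring "corner R f" by (rule t_fine_f)
  have "x [^]\<^bsub>corner R e\<^esub> (k + l) = x [^]\<^bsub>corner R e\<^esub> k \<otimes> x [^]\<^bsub>corner R e\<^esub> l"
    using E.nat_pow_mult[of x k l] x by simp
  then have "x [^]\<^bsub>corner R e\<^esub> (k + l) = \<zero>"
    using E.nat_pow_closed[of x l] x by (auto dest: peirceD)
  moreover have "y [^]\<^bsub>corner R f\<^esub> (k + l) = y [^]\<^bsub>corner R f\<^esub> k \<otimes> y [^]\<^bsub>corner R f\<^esub> l"
    using F.nat_pow_mult[of y k l] y by simp
  then have "y [^]\<^bsub>corner R f\<^esub> (k + l) = \<zero>"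
    using F.nat_pow_closed[of y k] y by (auto dest: peirceD)
  ultimately obtain h' where h': "h' \<in> peirce R e f" "(x \<oplus> y \<oplus> h) [^] (k + l) = h'"
    using pow_triangular[OF x(1) y(1) h, of "k + l"] by (metis peirceD(1) l_zero zero_closed)
  have "x \<oplus> y \<oplus> h \<in> carrier R" using x y h by (auto dest: peirceD)
  then have "(x \<oplus> y \<oplus> h) [^] ((k + l) + (k + l)) = h' \<otimes> h'"
    using h' by (simp only: nat_pow_mult[symmetric])
  also have "\<dots> = \<zero>" using h' peirce_mult_cross by blast
  finally show ?thesis by blast
qed

text \<open>The exponent \<open>k * l\<close> turns the diagonal into
  \<open>e \<oplus> f = \<one>\<close>. The remaining \<open>\<one> \<oplus> h'\<close> has
  square-zero \<open>h'\<close>, so its \<open>n\<close>-th power is \<open>\<one>\<close> plus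
  \<open>n\<close> times \<open>h'\<close>.\<close>

lemma finite_order_triangular:
  assumes x: "x \<in> peirce R e e" "x [^]\<^bsub>corner R e\<^esub> (k::nat) = e" "0 < k"
    and y: "y \<in> peirce R f f" "y [^]\<^bsub>corner R f\<^esub> (l::nat) = f" "0 < l" and h: "h \<in> peirce R e f"
  shows "\<exists>n::nat. 0 < n \<and> (x \<oplus> y \<oplus> h) [^] n = \<one>"
proof -
  interpret E: t_fine_ring "corner R e" by (rule t_fine_e)
  interpret F: t_fine_ring "corner R f" by (rule t_fine_f)
  \<comment> \<open>The characteristic is taken from the corner \<open>eRe\<close>, already known to
    be t-fine; it kills \<open>h'\<close> because \<open>h' = e \<otimes> h'\<close>.\<close>
  obtain N :: nat where N: "0 < N" "[N] \<cdot> e = \<zero>"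
    using E.char_pos by (auto simp: corner_add_pow)
  have "x [^]\<^bsub>corner R e\<^esub> (k * l) = e" "y [^]\<^bsub>corner R f\<^esub> (k * l) = f"
    using E.nat_pow_pow[of x k l] E.nat_pow_one[of l] F.nat_pow_pow[of y l k] F.nat_pow_one[of k] x y
    by (simp_all add: mult.commute)
  then obtain h' where h': "h' \<in> peirce R e f" "(x \<oplus> y \<oplus> h) [^] (k * l) = \<one> \<oplus> h'"
    using pow_triangular[OF x(1) y(1) h, of "k * l"] by (auto simp: e_plus_f)
  have hc: "h' \<in> carrier R" using h' by (auto dest: peirceD)
  have hh: "h' \<otimes> h' = \<zero>" using h' peirce_mult_cross by blast
  have "(\<one> \<oplus> h') [^] n = \<one> \<oplus> [n] \<cdot> h'" for n :: nat
    by (induction n) (use hc in \<open>simp_all add: l_distr r_distr add_pow_ldistr hh a_ac\<close>)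
  moreover have "[N] \<cdot> h' = [N] \<cdot> e \<otimes> h'"
    using h' hc e by (simp add: add_pow_ldistr peirceD(2))
  ultimately have "(\<one> \<oplus> h') [^] N = \<one>" using hc N by simp
  moreover have "x \<oplus> y \<oplus> h \<in> carrier R" using x y h by (auto dest: peirceD)
  ultimately have "(x \<oplus> y \<oplus> h) [^] (k * l * N) = \<one>" using h' by (simp add: nat_pow_pow[symmetric])
  then show ?thesis using x y N by (intro exI[of _ "k * l * N"]) simp
qed

lemma decompose:
  assumes "a \<in> carrier R"
  shows "a = e \<otimes> a \<otimes> e \<oplus> f \<otimes> a \<otimes> f \<oplus> e \<otimes> a \<otimes> f \<oplus> f \<otimes> a \<otimes> e"
proof -
  have "a = (e \<oplus> f) \<otimes> a \<otimes> (e \<oplus> f)" using assms by (simp add: e_plus_f)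
  also have "\<dots> = e \<otimes> a \<otimes> e \<oplus> f \<otimes> a \<otimes> f \<oplus> e \<otimes> a \<otimes> f \<oplus> f \<otimes> a \<otimes> e"
    using assms e f by (simp add: l_distr r_distr a_ac)
  finally show ?thesis .
qed

lemma sandwich:
  assumes "a \<in> carrier R"
  shows "e \<otimes> a \<otimes> e \<in> peirce R e e" "f \<otimes> a \<otimes> f \<in> peirce R f f"
    "e \<otimes> a \<otimes> f \<in> peirce R e f" "f \<otimes> a \<otimes> e \<in> peirce R f e"
  using assms e f by (simp_all add: peirce_sandwich)

lemma t_clean_of_diagonal:
  assumes a: "a \<in> carrier R" and ne: "e \<otimes> a \<otimes> e \<noteq> \<zero>" and nf: "f \<otimes> a \<otimes> f \<noteq> \<zero>"
  shows "t_clean R a"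
proof -
  interpret E: t_fine_ring "corner R e" by (rule t_fine_e)
  interpret F: t_fine_ring "corner R f" by (rule t_fine_f)
  interpret S: peirce_decomposition R f e by (rule swap)
  note s = sandwich[OF a]
  have "t_clean (corner R e) (e \<otimes> a \<otimes> e)"
    using s(1) ne t_fine_e by (simp add: t_fine_ring_iff)
  then obtain u b m k where u: "u \<in> peirce R e e" "0 < m" "u [^]\<^bsub>corner R e\<^esub> (m::nat) = e"
    and b: "b \<in> peirce R e e" "b [^]\<^bsub>corner R e\<^esub> (k::nat) = \<zero>" and ub: "e \<otimes> a \<otimes> e = u \<oplus> b"
    by (rule E.t_cleanE) auto
  have "t_clean (corner R f) (f \<otimes> a \<otimes> f)"
    using s(2) nf t_fine_f by (simp add: t_fine_ring_iff)
  then obtain u' b' m' k' where u': "u' \<in> peirce R f f" "0 < m'" "u' [^]\<^bsub>corner R f\<^esub> (m'::nat) = f"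
    and b': "b' \<in> peirce R f f" "b' [^]\<^bsub>corner R f\<^esub> (k'::nat) = \<zero>" and ub': "f \<otimes> a \<otimes> f = u' \<oplus> b'"
    by (rule F.t_cleanE) auto
  note c = u(1)[THEN peirceD(1)] b(1)[THEN peirceD(1)] u'(1)[THEN peirceD(1)] b'(1)[THEN peirceD(1)]
    s(3)[THEN peirceD(1)] s(4)[THEN peirceD(1)]
  obtain n :: nat where n: "0 < n" "(u \<oplus> u' \<oplus> e \<otimes> a \<otimes> f) [^] n = \<one>"
    using finite_order_triangular[OF u(1,3,2) u'(1,3,2) s(3)] by blast
  \<comment> \<open>This summand is lower triangular, hence upper triangular for the exchanged pair
    \<open>f\<close>, \<open>e\<close>.\<close>
  obtain l :: nat where l: "(b' \<oplus> b \<oplus> f \<otimes> a \<otimes> e) [^] l = \<zero>"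
    using S.nilpotent_triangular[OF b' b s(4)] by blast
  have "a = (u \<oplus> b) \<oplus> (u' \<oplus> b') \<oplus> e \<otimes> a \<otimes> f \<oplus> f \<otimes> a \<otimes> e"
    using decompose[OF a] by (simp only: ub ub')
  then have "a = (u \<oplus> u' \<oplus> e \<otimes> a \<otimes> f) \<oplus> (b' \<oplus> b \<oplus> f \<otimes> a \<otimes> e)"
    using c by (simp add: a_ac)
  then show ?thesis using n l c by (intro t_cleanI) auto
qed

end

subsection \<open>Conjugation by transvections\<close>

lemma (in ring) minus_eq_zero_iff:
  assumes "x \<in> carrier R" "y \<in> carrier R"
  shows "x \<ominus> y = \<zero> \<longleftrightarrow> x = y"
  using assms minus_equality[of x "\<ominus> y"] by (auto simp: minus_eq r_neg)

context peirce_decomposition begin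

text \<open>In block form: add \<open>h\<close> times the lower row to the upper one, then subtract
  the left column times \<open>h\<close> from the right one. The lower left block is fixed and
  governs the change of both diagonal blocks. The last formula uses the new upper left block so that
  it simplifies when that block vanishes.\<close>

lemma transvection:
  assumes a: "a \<in> carrier R" and h: "h \<in> peirce R e f"
  defines "a' \<equiv> (\<one> \<oplus> h) \<otimes> a \<otimes> (\<one> \<ominus> h)"
  shows "a' \<in> carrier R"
    and "t_clean R a' \<Longrightarrow> t_clean R a"
    and "e \<otimes> a' \<otimes> e = e \<otimes> a \<otimes> e \<oplus> h \<otimes> (f \<otimes> a \<otimes> e)"
    and "f \<otimes> a' \<otimes> f = f \<otimes> a \<otimes> f \<ominus> (f \<otimes> a \<otimes> e) \<otimes> h"
    and "f \<otimes> a' \<otimes> e = f \<otimes> a \<otimes> e"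
    and "e \<otimes> a' \<otimes> f = e \<otimes> a \<otimes> f \<oplus> h \<otimes> (f \<otimes> a \<otimes> f) \<ominus> (e \<otimes> a' \<otimes> e) \<otimes> h"
proof -
  have hc: "h \<in> carrier R" and eh: "e \<otimes> h = h" and hf: "h \<otimes> f = h" using h by (auto dest: peirceD)
  have hh: "h \<otimes> h = \<zero>" using h peirce_mult_cross by blast
  have fh: "f \<otimes> h = \<zero>" using peirce_mult_cross(1)[OF peirce_self[OF f(1,2)] h] .
  have he: "h \<otimes> e = \<zero>" using peirce_mult_cross(1)[OF h peirce_self[OF e(1,2)]] .
  show ac: "a' \<in> carrier R" using a hc by (simp add: a'_def)
  have "(\<one> \<oplus> h) \<otimes> (\<one> \<ominus> h) = \<one>" "(\<one> \<ominus> h) \<otimes> (\<one> \<oplus> h) = \<one>"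
    using hc by (simp_all add: minus_eq l_distr r_distr l_minus r_minus hh a_assoc l_neg r_neg)
  then show "t_clean R a' \<Longrightarrow> t_clean R a"
    unfolding a'_def using t_clean_conj[OF a, of "\<one> \<oplus> h" "\<one> \<ominus> h"] hc by simp
  have 1: "e \<otimes> (\<one> \<oplus> h) = e \<oplus> h" "f \<otimes> (\<one> \<oplus> h) = f" "(\<one> \<ominus> h) \<otimes> e = e" "(\<one> \<ominus> h) \<otimes> f = f \<ominus> h"
    using e f hc by (simp_all add: minus_eq l_distr r_distr l_minus eh hf fh he)
  have *: "p \<otimes> a' \<otimes> q = (p \<otimes> (\<one> \<oplus> h)) \<otimes> a \<otimes> ((\<one> \<ominus> h) \<otimes> q)" if "p \<in> carrier R" "q \<in> carrier R" for p q
    using that a hc by (simp add: a'_def m_assoc)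
  have ha: "h \<otimes> a \<otimes> q = h \<otimes> (f \<otimes> a \<otimes> q)" if "q \<in> carrier R" for q
    using that a hc f by (simp add: m_assoc[symmetric] hf)
  have ah: "p \<otimes> a \<otimes> h = (p \<otimes> a \<otimes> e) \<otimes> h" if "p \<in> carrier R" for p
    using that a hc e by (simp add: m_assoc eh)
  show ee: "e \<otimes> a' \<otimes> e = e \<otimes> a \<otimes> e \<oplus> h \<otimes> (f \<otimes> a \<otimes> e)"
    using a hc e f ha[of e] by (simp add: * 1 l_distr)
  show "f \<otimes> a' \<otimes> f = f \<otimes> a \<otimes> f \<ominus> (f \<otimes> a \<otimes> e) \<otimes> h"
    using a hc e f ah[of f] by (simp add: * 1) (simp add: minus_eq r_distr r_minus)
  show "f \<otimes> a' \<otimes> e = f \<otimes> a \<otimes> e" using a e f by (simp add: * 1)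
  have "e \<otimes> a' \<otimes> e = (e \<oplus> h) \<otimes> a \<otimes> e" using e by (simp add: * 1)
  then have "(e \<otimes> a' \<otimes> e) \<otimes> h = (e \<oplus> h) \<otimes> a \<otimes> h" using e a hc ah[of "e \<oplus> h"] by simp
  moreover have "e \<otimes> a' \<otimes> f = (e \<oplus> h) \<otimes> a \<otimes> f \<ominus> (e \<oplus> h) \<otimes> a \<otimes> h"
    using a hc e f by (simp add: * 1) (simp add: minus_eq r_distr r_minus)
  moreover have "(e \<oplus> h) \<otimes> a \<otimes> f = e \<otimes> a \<otimes> f \<oplus> h \<otimes> (f \<otimes> a \<otimes> f)"
    using a hc e f ha[of f] by (simp add: l_distr)
  ultimately show "e \<otimes> a' \<otimes> f = e \<otimes> a \<otimes> f \<oplus> h \<otimes> (f \<otimes> a \<otimes> f) \<ominus> (e \<otimes> a' \<otimes> e) \<otimes> h"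
    by simp
qed

text \<open>Primeness applied to \<open>z\<close> and the non-zero \<open>f\<close> gives
  \<open>zsf\<close> non-zero; as \<open>z = z \<otimes> e\<close>, the factor \<open>sf\<close> may
  be replaced by \<open>esf\<close>.\<close>

lemma faithful_right:
  assumes z: "z \<in> peirce R u e" "z \<noteq> \<zero>"
  shows "\<exists>h\<in>peirce R e f. z \<otimes> h \<noteq> \<zero>"
proof -
  have zc: "z \<in> carrier R" "z \<otimes> e = z" using z by (auto dest: peirceD)
  obtain s where s: "s \<in> carrier R" "z \<otimes> s \<otimes> f \<noteq> \<zero>" using prime[of z f] zc z f by blast
  have "z \<otimes> s \<otimes> f = (z \<otimes> e) \<otimes> s \<otimes> f" using zc by simp
  also have "\<dots> = z \<otimes> (e \<otimes> s \<otimes> f)" using zc(1) s e f by (simp add: m_assoc)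
  finally show ?thesis using s sandwich(3) by metis
qed

lemma faithful_left:
  assumes z: "z \<in> peirce R f u" "z \<noteq> \<zero>"
  shows "\<exists>h\<in>peirce R e f. h \<otimes> z \<noteq> \<zero>"
proof -
  have zc: "z \<in> carrier R" "f \<otimes> z = z" using z by (auto dest: peirceD)
  obtain s where s: "s \<in> carrier R" "e \<otimes> s \<otimes> z \<noteq> \<zero>" using prime[of e z] zc z e by blast
  have "e \<otimes> s \<otimes> z = e \<otimes> s \<otimes> (f \<otimes> z)" using zc by simp
  also have "\<dots> = (e \<otimes> s \<otimes> f) \<otimes> z" using zc(1) s e f by (simp add: m_assoc)
  finally show ?thesis using s sandwich(3) by metis
qed

text \<open>Primeness supplies \<open>h\<close> in \<open>eRf\<close> with \<open>ghg\<close>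
  non-zero, where \<open>g = fae\<close>. Then \<open>hg\<close> and \<open>gh\<close> are both
  non-zero, and up to sign they are the diagonal blocks after conjugation.\<close>

lemma t_clean_of_zero_diagonal:
  assumes a: "a \<in> carrier R" and "e \<otimes> a \<otimes> e = \<zero>" "f \<otimes> a \<otimes> f = \<zero>" and ne: "f \<otimes> a \<otimes> e \<noteq> \<zero>"
  shows "t_clean R a"
proof -
  define g where "g = f \<otimes> a \<otimes> e"
  have g: "g \<in> carrier R" "g \<otimes> e = g" "f \<otimes> g = g" "g \<noteq> \<zero>"
    using sandwich(4)[OF a] ne by (auto simp: g_def dest: peirceD)
  obtain s where s: "s \<in> carrier R" "g \<otimes> s \<otimes> g \<noteq> \<zero>" using prime[of g g] g by blast
  define h where "h = e \<otimes> s \<otimes> f"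
  have h: "h \<in> peirce R e f" using s sandwich by (simp add: h_def)
  then have hc: "h \<in> carrier R" by (rule peirceD)
  have "g \<otimes> s \<otimes> g = (g \<otimes> e) \<otimes> s \<otimes> (f \<otimes> g)" using g by simp
  also have "\<dots> = g \<otimes> h \<otimes> g" using g(1) s e f by (simp add: h_def m_assoc)
  finally have "g \<otimes> h \<otimes> g \<noteq> \<zero>" using s by simp
  then have nz: "g \<otimes> h \<noteq> \<zero>" "h \<otimes> g \<noteq> \<zero>" using g hc m_assoc[of g h g] by auto
  note t = transvection[OF a h]
  have "\<zero> \<ominus> g \<otimes> h \<noteq> \<zero>" using nz g hc by (simp add: minus_eq)
  then show ?thesis
    using assms nz g hc by (intro t(2) t_clean_of_diagonal[OF t(1)]) (simp_all add: t(3,4) g_def[symmetric])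
qed

text \<open>The transvections by \<open>h \<in> eRf\<close> can only fail to make both diagonal blocks non-zero when
  \<open>R\<close> is the ring of \<open>2 \<times> 2\<close> matrices over the field with two elements. There the
  matrix with rows \<open>1 1\<close> and \<open>1 0\<close> is a unit of order 3.\<close>

lemma t_clean_of_lower_left:
  assumes a: "a \<in> carrier R" and ee: "e \<otimes> a \<otimes> e \<noteq> \<zero>" and ff: "f \<otimes> a \<otimes> f = \<zero>"
    and fe_a: "f \<otimes> a \<otimes> e \<noteq> \<zero>"
  shows "t_clean R a"
proof (rule ccontr)
  assume not_clean: "\<not> t_clean R a"
  define c where "c = e \<otimes> a \<otimes> e"
  define g where "g = f \<otimes> a \<otimes> e"
  have c: "c \<in> peirce R e e" "c \<noteq> \<zero>" and g: "g \<in> peirce R f e" "g \<noteq> \<zero>"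
    using sandwich[OF a] ee fe_a by (auto simp: c_def g_def)
  note cc = peirceD(1)[OF c(1)] and gc = peirceD[OF g(1)]
  \<comment> \<open>Conjugation by \<open>\<one> \<oplus> h\<close> produces the diagonal blocks
    \<open>c \<oplus> h \<otimes> g\<close> and \<open>\<ominus> (g \<otimes> h)\<close>. The second
    is non-zero, so the first must vanish.\<close>
  have key: "h \<otimes> g = \<ominus> c" if h: "h \<in> peirce R e f" "g \<otimes> h \<noteq> \<zero>" for h
  proof (rule ccontr)
    assume ne: "h \<otimes> g \<noteq> \<ominus> c"
    note hc = peirceD(1)[OF h(1)]
    note t = transvection[OF a h(1)]
    have "c \<oplus> h \<otimes> g \<noteq> \<zero>"
      using ne cc gc hc minus_equality[of "h \<otimes> g" c] by (auto simp: a_comm)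
    moreover have "\<zero> \<ominus> g \<otimes> h \<noteq> \<zero>" using h gc hc by (simp add: minus_eq)
    ultimately have "t_clean R a"
      using a ff by (intro t(2) t_clean_of_diagonal[OF t(1)]) (simp_all add: t(3,4) g_def c_def)
    then show False using not_clean by blast
  qed
  obtain h where h: "h \<in> peirce R e f" "g \<otimes> h \<noteq> \<zero>" using faithful_right[OF g] by blast
  note hc = peirceD[OF h(1)]
  \<comment> \<open>Adding \<open>k' = k(fsf)\<close> to \<open>h\<close> leaves
    \<open>g \<otimes> h\<close> unchanged, so \<open>key\<close> applies to both and forces
    \<open>k' \<otimes> g = \<zero>\<close>. As \<open>s\<close> is arbitrary, primeness yields
    \<open>k = \<zero>\<close>.\<close>
  have inj: "k = \<zero>" if k: "k \<in> peirce R e f" "g \<otimes> k = \<zero>" for k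
  proof (rule prime[of k g])
    fix s assume s: "s \<in> carrier R"
    note kc = peirceD[OF k(1)]
    define k' where "k' = k \<otimes> (f \<otimes> s \<otimes> f)"
    have k': "k' \<in> peirce R e f"
      unfolding k'_def by (rule peirce_mult[OF k(1) sandwich(2)[OF s] e(1) f(1)])
    note k'c = peirceD(1)[OF k']
    have "g \<otimes> k' = (g \<otimes> k) \<otimes> (f \<otimes> s \<otimes> f)" unfolding k'_def using gc kc s f by (simp add: m_assoc)
    then have "g \<otimes> (h \<oplus> k') = g \<otimes> h" using gc kc s f hc k k'c by (simp add: r_distr)
    then have "(h \<oplus> k') \<otimes> g = \<ominus> c" using h k' e f by (intro key) (simp_all add: peirce_add)
    then have "h \<otimes> g \<oplus> k' \<otimes> g = h \<otimes> g" using key[OF h] gc hc k'c by (simp add: l_distr)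
    then have "k' \<otimes> g = \<zero>" using gc(1) hc(1) k'c by simp
    moreover have "k' \<otimes> g = (k \<otimes> f) \<otimes> s \<otimes> (f \<otimes> g)" unfolding k'_def using gc(1) kc(1) s f by (simp add: m_assoc)
    ultimately show "k \<otimes> s \<otimes> g = \<zero>" using kc gc by simp
  qed (use k g in \<open>auto dest: peirceD\<close>)
  \<comment> \<open>By \<open>inj\<close> and \<open>key\<close>, every non-zero element of
    \<open>eRf\<close> sends \<open>g\<close> to \<open>\<ominus> c\<close>. A difference of two of
    them sends \<open>g\<close> to zero, which is not \<open>\<ominus> c\<close>, so the difference
    is zero.\<close>
  have uniq: "k = h" if k: "k \<in> peirce R e f" "k \<noteq> \<zero>" for k
  proof -
    note kc = peirceD(1)[OF k(1)]
    have kh: "k \<ominus> h \<in> peirce R e f" using k h e f by (simp add: peirce_minus)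
    have "k \<otimes> g = \<ominus> c" using k inj key by blast
    then have "(k \<ominus> h) \<otimes> g = \<zero>" using key[OF h] kc hc gc cc by (simp add: minus_eq l_distr l_minus l_neg)
    moreover have "\<ominus> c \<noteq> \<zero>" using c cc by (metis minus_minus minus_zero)
    ultimately have "(k \<ominus> h) \<otimes> g \<noteq> \<ominus> c" by simp
    then have "k \<ominus> h = \<zero>" using kh inj key by blast
    then show ?thesis using kc hc by (simp add: minus_eq_zero_iff)
  qed
  \<comment> \<open>As \<open>h\<close> is the only non-zero element of \<open>eRf\<close>, an
    element of \<open>eRe\<close> killing \<open>h\<close> is zero. Thus
    \<open>z \<otimes> h\<close> is non-zero, so it equals \<open>h\<close>, and
    \<open>z \<ominus> e\<close> kills \<open>h\<close>.\<close>
  have e_only: "z = e" if z: "z \<in> peirce R e e" "z \<noteq> \<zero>" for z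
  proof -
    note zc = peirceD[OF z(1)]
    have inj_h: "w = \<zero>" if w: "w \<in> peirce R e e" "w \<otimes> h = \<zero>" for w
      using faithful_right[OF w(1)] uniq w peirceD(1)[OF w(1)] by (metis r_null)
    have "z \<otimes> h \<in> peirce R e f" by (rule peirce_mult[OF z(1) h(1) e(1) f(1)])
    then have "z \<otimes> h = h" using uniq inj_h z by blast
    then have "(z \<ominus> e) \<otimes> h = \<zero>" using zc hc e by (simp add: minus_eq l_distr l_minus r_neg)
    moreover have "z \<ominus> e \<in> peirce R e e" using z e by (simp add: peirce_minus peirce_self)
    ultimately have "z \<ominus> e = \<zero>" using inj_h by blast
    then show ?thesis using zc e by (simp add: minus_eq_zero_iff)
  qed
  have ce: "c = e" using e_only c by blast
  \<comment> \<open>Characteristic two: \<open>\<ominus> e\<close> is also a non-zero element of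
    \<open>eRe\<close>.\<close>
  have "\<ominus> e = e" using e e_only[of "\<ominus> e"] peirce_self[of e] by (simp add: peirce_uminus)
  then have hg: "h \<otimes> g = e" and e2: "e \<oplus> e = \<zero>" using key[OF h] e r_neg[of e] by (auto simp: ce)
  have h2: "h \<oplus> h = \<zero>" using l_distr[of e e h] e2 e hc by simp
  \<comment> \<open>From \<open>h \<otimes> g = e\<close> it follows that \<open>h\<close>
    annihilates \<open>g \<otimes> h \<ominus> f\<close>, and so does all of \<open>eRf\<close>; by
    faithfulness this element is zero.\<close>
  have gh: "g \<otimes> h = f"
  proof (rule ccontr)
    assume ne: "g \<otimes> h \<noteq> f"
    define w where "w = g \<otimes> h \<ominus> f"
    have w: "w \<in> peirce R f f"
      unfolding w_def using peirce_mult[OF g(1) h(1) f(1) f(1)] f by (simp add: peirce_minus peirce_self)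
    have "w \<noteq> \<zero>" using ne gc hc f by (simp add: w_def minus_eq_zero_iff)
    then obtain k where k: "k \<in> peirce R e f" "k \<otimes> w \<noteq> \<zero>" using faithful_left[OF w] by blast
    then have "k = h" using uniq peirceD(1)[OF w] by (metis l_null)
    moreover have "h \<otimes> w = (h \<otimes> g) \<otimes> h \<ominus> h \<otimes> f"
      using hc(1) gc(1) f by (simp add: w_def minus_eq r_distr r_minus m_assoc)
    then have "h \<otimes> w = \<zero>" using hc by (simp add: hg minus_eq r_neg)
    ultimately show False using k by simp
  qed
  have zs: "f \<otimes> h = \<zero>" "h \<otimes> e = \<zero>" "h \<otimes> h = \<zero>" "g \<otimes> g = \<zero>" "e \<otimes> g = \<zero>" "g \<otimes> f = \<zero>"
    using peirce_mult_cross peirce_self[OF e(1,2)] peirce_self[OF f(1,2)] h g by blast+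
  \<comment> \<open>Now \<open>e\<close>, \<open>h\<close>, \<open>g\<close>, \<open>f\<close>
    multiply like the matrix units at positions 11, 12, 21, 22, and \<open>u\<close> is the
    announced element of order 3.\<close>
  define u where "u = e \<oplus> g \<oplus> h"
  have uc: "u \<in> carrier R" using e gc hc by (simp add: u_def)
  have "u \<otimes> u = (e \<oplus> e) \<oplus> (g \<oplus> h \<oplus> f)"
    using e f gc hc by (simp add: u_def l_distr r_distr hg gh zs a_ac)
  then have "u \<otimes> u = g \<oplus> h \<oplus> f" using e2 gc hc f by simp
  then have "u \<otimes> (u \<otimes> u) = (e \<oplus> g \<oplus> h) \<otimes> (g \<oplus> h \<oplus> f)" by (simp add: u_def)
  also have "\<dots> = (h \<oplus> h) \<oplus> (e \<oplus> f)"
    using e f gc hc by (simp add: l_distr r_distr hg gh zs ef a_ac)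
  finally have "u \<otimes> u \<otimes> u = (h \<oplus> h) \<oplus> (e \<oplus> f)" using uc by (simp add: m_assoc)
  then have u3: "u [^] (3::nat) = \<one>" using h2 uc by (simp add: numeral_3_eq_3 e_plus_f)
  \<comment> \<open>Since \<open>c = e\<close> and the lower right block is zero, \<open>a\<close>
    and \<open>u\<close> differ only in \<open>eRf\<close>, where every element squares to
    zero.\<close>
  define b where "b = e \<otimes> a \<otimes> f \<ominus> h"
  have b: "b \<in> peirce R e f" unfolding b_def using sandwich[OF a] h e f by (simp add: peirce_minus)
  then have "b \<otimes> b = \<zero>" using peirce_mult_cross by blast
  then have b2: "b [^] (2::nat) = \<zero>" using peirceD(1)[OF b] by (simp add: numeral_2_eq_2)
  have ea: "e \<otimes> a \<otimes> f \<in> carrier R" using a e f by simp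
  have "a = e \<oplus> e \<otimes> a \<otimes> f \<oplus> g"
    using decompose[OF a] ea e gc by (simp add: ff g_def[symmetric] c_def[symmetric] ce)
  also have "\<dots> = u \<oplus> b" using e gc hc ea
    by (simp add: u_def b_def minus_eq a_ac r_neg1 r_neg2)
  finally have "a = u \<oplus> b" .
  then have "t_clean R a" using u3 b2 uc peirceD(1)[OF b] by (intro t_cleanI[of u b 3 2]) auto
  then show False using not_clean by blast
qed

text \<open>If the lower left block vanishes too, a transvection by some \<open>g\<close> in
  \<open>fRe\<close> with \<open>g(eae)\<close> non-zero leads to one of the shapes already
  treated.\<close>

lemma t_clean_of_upper_block:
  assumes a: "a \<in> carrier R" and ee: "e \<otimes> a \<otimes> e \<noteq> \<zero>" and ff: "f \<otimes> a \<otimes> f = \<zero>"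
  shows "t_clean R a"
proof (cases "f \<otimes> a \<otimes> e = \<zero>")
  case False
  then show ?thesis using assms t_clean_of_lower_left by blast
next
  case True
  interpret S: peirce_decomposition R f e by (rule swap)
  obtain g where g: "g \<in> peirce R f e" "g \<otimes> (e \<otimes> a \<otimes> e) \<noteq> \<zero>"
    using S.faithful_left[OF sandwich(1)[OF a] ee] by blast
  note gc = peirceD(1)[OF g(1)]
  define a' where "a' = (\<one> \<oplus> g) \<otimes> a \<otimes> (\<one> \<ominus> g)"
  note t = S.transvection[OF a g(1), folded a'_def]
  have ac: "e \<otimes> a \<otimes> f \<in> carrier R" "e \<otimes> a \<otimes> e \<in> carrier R" using a e f by auto
  have ff': "f \<otimes> a' \<otimes> f = g \<otimes> (e \<otimes> a \<otimes> f)" using t(3) gc ac by (simp add: ff)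
  have fe': "f \<otimes> a' \<otimes> e = g \<otimes> (e \<otimes> a \<otimes> e) \<ominus> (f \<otimes> a' \<otimes> f) \<otimes> g"
    using t(6) gc ac by (simp add: True)
  consider "e \<otimes> a' \<otimes> e \<noteq> \<zero>" "f \<otimes> a' \<otimes> f \<noteq> \<zero>" | "e \<otimes> a' \<otimes> e = \<zero>" "f \<otimes> a' \<otimes> f \<noteq> \<zero>"
    | "f \<otimes> a' \<otimes> f = \<zero>" by blast
  then have "t_clean R a'"
  proof cases
    case 1
    then show ?thesis using t_clean_of_diagonal[OF t(1)] by blast
  next
    case 2
    \<comment> \<open>The new lower right block is \<open>g(eaf)\<close>, so \<open>eaf\<close> is
      non-zero, and the transvection does not change that block.\<close>
    then have "e \<otimes> a' \<otimes> f \<noteq> \<zero>" using t(5) ff' gc by auto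
    then show ?thesis using S.t_clean_of_lower_left[OF t(1)] 2 by blast
  next
    case 3
    \<comment> \<open>With the lower right block zero, the new lower left block is exactly
      \<open>g(eae)\<close>.\<close>
    then have "f \<otimes> a' \<otimes> e \<noteq> \<zero>" using fe' g gc ac by (simp add: minus_eq)
    then show ?thesis
      using 3 t_clean_of_lower_left[OF t(1)] t_clean_of_zero_diagonal[OF t(1)] by blast
  qed
  then show ?thesis by (rule t(2))
qed

text \<open>A non-zero element has a non-zero block. The cases are: two non-zero diagonal blocks,
  exactly one, or none; the last two are covered up to exchanging \<open>e\<close> and
  \<open>f\<close>.\<close>

lemma t_fine_whole: "t_fine_ring R"
  unfolding t_fine_ring_iff
proof (intro conjI ballI impI)
  fix a assume a: "a \<in> carrier R" and ne: "a \<noteq> \<zero>"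
  interpret S: peirce_decomposition R f e by (rule swap)
  have "e \<otimes> a \<otimes> e \<noteq> \<zero> \<or> f \<otimes> a \<otimes> f \<noteq> \<zero> \<or> e \<otimes> a \<otimes> f \<noteq> \<zero> \<or> f \<otimes> a \<otimes> e \<noteq> \<zero>"
    using decompose[OF a] ne by auto
  then show "t_clean R a"
    using t_clean_of_diagonal[OF a] t_clean_of_zero_diagonal[OF a] t_clean_of_upper_block[OF a]
      S.t_clean_of_zero_diagonal[OF a] S.t_clean_of_upper_block[OF a] by blast
qed (rule ring_axioms)

end

text \<open>The induction step for matrices. Inside the corner at \<open>e \<oplus> f\<close> this
  sum is the identity, so the decomposition argument applies there; if one idempotent is zero, the
  sum is the other.\<close>

lemma (in prime_ring) t_fine_corner_add:
  assumes e: "e \<in> carrier R" "e \<otimes> e = e" and f: "f \<in> carrier R" "f \<otimes> f = f"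
    and ef: "e \<otimes> f = \<zero>" "f \<otimes> e = \<zero>"
    and tf: "t_fine_ring (corner R e)" "t_fine_ring (corner R f)"
  shows "t_fine_ring (corner R (e \<oplus> f))"
proof (cases "e = \<zero> \<or> f = \<zero>")
  case True
  then show ?thesis using tf e f by auto
next
  case False
  define c where "c = e \<oplus> f"
  have c: "c \<in> carrier R" "c \<otimes> c = c" and ce: "c \<otimes> e = e" "e \<otimes> c = e" "c \<otimes> f = f" "f \<otimes> c = f"
    using e f ef by (simp_all add: c_def l_distr r_distr)
  interpret C: prime_ring "corner R c" using c by (rule prime_ring_corner)
  have "peirce_decomposition (corner R c) e f"
    unfolding peirce_decomposition_def peirce_decomposition_axioms_def
    by (use C.prime_ring_axioms e f ef ce c tf False in \<open>simp_all add: peirce_def corner_corner c_def[symmetric]\<close>)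
  then show ?thesis unfolding c_def by (rule peirce_decomposition.t_fine_whole)
qed

subsection \<open>Matrix rings\<close>

context ring begin

lemma matrix_ring_sel:
  "carrier (matrix_ring n R) = {A \<in> carrier_mat n n. \<forall>i<n. \<forall>j<n. A $$ (i, j) \<in> carrier R}"
  "A \<otimes>\<^bsub>matrix_ring n R\<^esub> B = mat n n (\<lambda>(i, j). \<Oplus>k\<in>{..<n}. A $$ (i, k) \<otimes> B $$ (k, j))"
  "A \<oplus>\<^bsub>matrix_ring n R\<^esub> B = mat n n (\<lambda>(i, j). A $$ (i, j) \<oplus> B $$ (i, j))"
  "\<one>\<^bsub>matrix_ring n R\<^esub> = mat n n (\<lambda>(i, j). if i = j then \<one> else \<zero>)"
  "\<zero>\<^bsub>matrix_ring n R\<^esub> = mat n n (\<lambda>(i, j). \<zero>)"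
  by (simp_all add: matrix_ring_def)

lemma matrix_entry:
  "A \<in> carrier (matrix_ring n R) \<Longrightarrow> i < n \<Longrightarrow> j < n \<Longrightarrow> A $$ (i, j) \<in> carrier R"
  by (simp add: matrix_ring_sel)

lemma matrix_eqI:
  assumes "A \<in> carrier (matrix_ring n R)" "B \<in> carrier (matrix_ring n R)"
    and "\<And>i j. i < n \<Longrightarrow> j < n \<Longrightarrow> A $$ (i, j) = B $$ (i, j)"
  shows "A = B"
  using assms by (intro eq_matI) (auto simp: matrix_ring_sel)

lemma finsum_delta:
  assumes "i < (n::nat)" "f i \<in> carrier R"
  shows "(\<Oplus>k\<in>{..<n}. if k = i then f k else \<zero>) = f i"
proof -
  have "(\<Oplus>k\<in>{..<n}. if k = i then f k else \<zero>) = (\<Oplus>k\<in>{..<n}. if i = k then f i else \<zero>)"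
    using assms by (intro finsum_cong) (auto simp: simp_implies_def)
  also have "\<dots> = f i" using assms by (intro finsum_singleton) auto
  finally show ?thesis .
qed

lemma matrix_mult_closed:
  assumes "A \<in> carrier (matrix_ring n R)" "B \<in> carrier (matrix_ring n R)"
  shows "A \<otimes>\<^bsub>matrix_ring n R\<^esub> B \<in> carrier (matrix_ring n R)"
  using assms by (auto simp: matrix_ring_sel intro!: finsum_closed)

lemma matrix_mult_entry:
  "i < n \<Longrightarrow> j < n \<Longrightarrow>
    (A \<otimes>\<^bsub>matrix_ring n R\<^esub> B) $$ (i, j) = (\<Oplus>k\<in>{..<n}. A $$ (i, k) \<otimes> B $$ (k, j))"
  by (simp add: matrix_ring_sel)

text \<open>Indexing by a set of positions turns intersections into products and disjoint unions
  into sums, which suits induction on the set.\<close>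

definition diag_proj :: "nat \<Rightarrow> nat set \<Rightarrow> 'a mat" where
  "diag_proj n I = mat n n (\<lambda>(i, j). if i = j \<and> i \<in> I then \<one> else \<zero>)"

lemma diag_proj_closed [simp]: "diag_proj n I \<in> carrier (matrix_ring n R)"
  by (simp add: matrix_ring_sel diag_proj_def)

lemma diag_proj_mult_left:
  assumes A: "A \<in> carrier (matrix_ring n R)" and "i < n" "j < n"
  shows "(diag_proj n I \<otimes>\<^bsub>matrix_ring n R\<^esub> A) $$ (i, j) = (if i \<in> I then A $$ (i, j) else \<zero>)"
proof -
  have "(diag_proj n I \<otimes>\<^bsub>matrix_ring n R\<^esub> A) $$ (i, j)
    = (\<Oplus>k\<in>{..<n}. if k = i then (if i \<in> I then A $$ (k, j) else \<zero>) else \<zero>)"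
    unfolding matrix_mult_entry[OF assms(2,3)] using assms
    by (intro finsum_cong') (auto simp: diag_proj_def matrix_entry)
  also have "\<dots> = (if i \<in> I then A $$ (i, j) else \<zero>)"
    using assms by (subst finsum_delta) (auto simp: matrix_entry)
  finally show ?thesis .
qed

lemma diag_proj_mult_right:
  assumes A: "A \<in> carrier (matrix_ring n R)" and "i < n" "j < n"
  shows "(A \<otimes>\<^bsub>matrix_ring n R\<^esub> diag_proj n I) $$ (i, j) = (if j \<in> I then A $$ (i, j) else \<zero>)"
proof -
  have "(A \<otimes>\<^bsub>matrix_ring n R\<^esub> diag_proj n I) $$ (i, j)
    = (\<Oplus>k\<in>{..<n}. if k = j then (if j \<in> I then A $$ (i, k) else \<zero>) else \<zero>)"
    unfolding matrix_mult_entry[OF assms(2,3)] using assms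
    by (intro finsum_cong') (auto simp: diag_proj_def matrix_entry)
  also have "\<dots> = (if j \<in> I then A $$ (i, j) else \<zero>)"
    using assms by (subst finsum_delta) (auto simp: matrix_entry)
  finally show ?thesis .
qed

lemma matrix_one_eq: "\<one>\<^bsub>matrix_ring n R\<^esub> = diag_proj n {..<n}"
  by (intro eq_matI) (auto simp: matrix_ring_sel diag_proj_def)

lemma matrix_zero_eq: "\<zero>\<^bsub>matrix_ring n R\<^esub> = diag_proj n {}"
  by (intro eq_matI) (auto simp: matrix_ring_sel diag_proj_def)

lemma diag_proj_mult:
  "diag_proj n I \<otimes>\<^bsub>matrix_ring n R\<^esub> diag_proj n J = diag_proj n (I \<inter> J)"
  by (rule matrix_eqI[where n=n])
    (auto simp: diag_proj_mult_left matrix_mult_closed, auto simp: diag_proj_def)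

lemma diag_proj_add:
  "I \<inter> J = {} \<Longrightarrow> diag_proj n I \<oplus>\<^bsub>matrix_ring n R\<^esub> diag_proj n J = diag_proj n (I \<union> J)"
  by (intro eq_matI) (auto simp: matrix_ring_sel diag_proj_def)

lemma matrix_mult_assoc:
  assumes A: "A \<in> carrier (matrix_ring n R)" and B: "B \<in> carrier (matrix_ring n R)"
    and C: "C \<in> carrier (matrix_ring n R)"
  shows "A \<otimes>\<^bsub>matrix_ring n R\<^esub> B \<otimes>\<^bsub>matrix_ring n R\<^esub> C
    = A \<otimes>\<^bsub>matrix_ring n R\<^esub> (B \<otimes>\<^bsub>matrix_ring n R\<^esub> C)"
proof (rule matrix_eqI)
  fix i j assume ij: "i < n" "j < n"
  have c: "A $$ (i, k) \<in> carrier R" "B $$ (k, l) \<in> carrier R" "C $$ (k, j) \<in> carrier R"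
    if "k < n" "l < n" for k l
    using A B C ij that by (simp_all add: matrix_entry)
  have "(A \<otimes>\<^bsub>matrix_ring n R\<^esub> B \<otimes>\<^bsub>matrix_ring n R\<^esub> C) $$ (i, j)
    = (\<Oplus>k\<in>{..<n}. \<Oplus>l\<in>{..<n}. A $$ (i, l) \<otimes> B $$ (l, k) \<otimes> C $$ (k, j))"
    unfolding matrix_mult_entry[OF ij] using ij c
    by (intro finsum_cong') (auto simp: matrix_mult_entry finsum_ldistr Pi_def intro!: finsum_closed)
  also have "\<dots> = (\<Oplus>l\<in>{..<n}. \<Oplus>k\<in>{..<n}. A $$ (i, l) \<otimes> B $$ (l, k) \<otimes> C $$ (k, j))"
    using c by (intro finsum_finsum_swap) (auto simp: Pi_def)
  also have "\<dots> = (A \<otimes>\<^bsub>matrix_ring n R\<^esub> (B \<otimes>\<^bsub>matrix_ring n R\<^esub> C)) $$ (i, j)"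
    unfolding matrix_mult_entry[OF ij] using ij c
    by (intro finsum_cong')
      (auto simp: matrix_mult_entry finsum_rdistr Pi_def m_assoc intro!: finsum_closed finsum_cong')
  finally show "(A \<otimes>\<^bsub>matrix_ring n R\<^esub> B \<otimes>\<^bsub>matrix_ring n R\<^esub> C) $$ (i, j)
    = (A \<otimes>\<^bsub>matrix_ring n R\<^esub> (B \<otimes>\<^bsub>matrix_ring n R\<^esub> C)) $$ (i, j)" .
qed (use assms in \<open>simp_all add: matrix_mult_closed\<close>)

lemma ring_matrix_ring: "ring (matrix_ring n R)"
proof (rule ringI)
  show "abelian_group (matrix_ring n R)"
  proof (rule abelian_groupI)
    fix A assume "A \<in> carrier (matrix_ring n R)"
    then show "\<exists>B\<in>carrier (matrix_ring n R). B \<oplus>\<^bsub>matrix_ring n R\<^esub> A = \<zero>\<^bsub>matrix_ring n R\<^esub>"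
      by (intro bexI[of _ "mat n n (\<lambda>ij. \<ominus> A $$ ij)"]) (auto simp: matrix_ring_sel l_neg)
  qed (auto simp: matrix_ring_sel a_assoc intro!: eq_matI, simp add: a_comm)
  show "monoid (matrix_ring n R)"
  proof (rule monoidI)
    fix A assume A: "A \<in> carrier (matrix_ring n R)"
    show "\<one>\<^bsub>matrix_ring n R\<^esub> \<otimes>\<^bsub>matrix_ring n R\<^esub> A = A" "A \<otimes>\<^bsub>matrix_ring n R\<^esub> \<one>\<^bsub>matrix_ring n R\<^esub> = A"
      unfolding matrix_one_eq
      using A by (auto simp: matrix_mult_closed diag_proj_mult_left diag_proj_mult_right
          intro!: matrix_eqI[where n=n])
  qed (simp_all add: matrix_one_eq matrix_mult_closed matrix_mult_assoc)
next
  fix A B C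
  assume A: "A \<in> carrier (matrix_ring n R)" and B: "B \<in> carrier (matrix_ring n R)"
    and C: "C \<in> carrier (matrix_ring n R)"
  have c: "A $$ (i, k) \<in> carrier R" "B $$ (i, k) \<in> carrier R" "C $$ (i, k) \<in> carrier R"
    if "k < n" "i < n" for k i
    using A B C that by (simp_all add: matrix_entry)
  have "(\<Oplus>k\<in>{..<n}. (A \<oplus>\<^bsub>matrix_ring n R\<^esub> B) $$ (i, k) \<otimes> C $$ (k, j))
    = (\<Oplus>k\<in>{..<n}. A $$ (i, k) \<otimes> C $$ (k, j)) \<oplus> (\<Oplus>k\<in>{..<n}. B $$ (i, k) \<otimes> C $$ (k, j))"
    if "i < n" "j < n" for i j
  proof -
    have "(\<Oplus>k\<in>{..<n}. (A \<oplus>\<^bsub>matrix_ring n R\<^esub> B) $$ (i, k) \<otimes> C $$ (k, j))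
      = (\<Oplus>k\<in>{..<n}. A $$ (i, k) \<otimes> C $$ (k, j) \<oplus> B $$ (i, k) \<otimes> C $$ (k, j))"
      using that c by (intro finsum_cong') (auto simp: matrix_ring_sel(3) l_distr)
    then show ?thesis using that c by (simp add: finsum_addf Pi_def)
  qed
  then show "(A \<oplus>\<^bsub>matrix_ring n R\<^esub> B) \<otimes>\<^bsub>matrix_ring n R\<^esub> C
    = A \<otimes>\<^bsub>matrix_ring n R\<^esub> C \<oplus>\<^bsub>matrix_ring n R\<^esub> B \<otimes>\<^bsub>matrix_ring n R\<^esub> C"
    unfolding matrix_ring_sel(2) by (intro eq_matI) (simp_all add: matrix_ring_sel(3))
  have "(\<Oplus>k\<in>{..<n}. C $$ (i, k) \<otimes> (A \<oplus>\<^bsub>matrix_ring n R\<^esub> B) $$ (k, j))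
    = (\<Oplus>k\<in>{..<n}. C $$ (i, k) \<otimes> A $$ (k, j)) \<oplus> (\<Oplus>k\<in>{..<n}. C $$ (i, k) \<otimes> B $$ (k, j))"
    if "i < n" "j < n" for i j
  proof -
    have "(\<Oplus>k\<in>{..<n}. C $$ (i, k) \<otimes> (A \<oplus>\<^bsub>matrix_ring n R\<^esub> B) $$ (k, j))
      = (\<Oplus>k\<in>{..<n}. C $$ (i, k) \<otimes> A $$ (k, j) \<oplus> C $$ (i, k) \<otimes> B $$ (k, j))"
      using that c by (intro finsum_cong') (auto simp: matrix_ring_sel(3) r_distr)
    then show ?thesis using that c by (simp add: finsum_addf Pi_def)
  qed
  then show "C \<otimes>\<^bsub>matrix_ring n R\<^esub> (A \<oplus>\<^bsub>matrix_ring n R\<^esub> B)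
    = C \<otimes>\<^bsub>matrix_ring n R\<^esub> A \<oplus>\<^bsub>matrix_ring n R\<^esub> C \<otimes>\<^bsub>matrix_ring n R\<^esub> B"
    unfolding matrix_ring_sel(2) by (intro eq_matI) (simp_all add: matrix_ring_sel(3))
qed

text \<open>The coefficient comes last, so that \<open>mat_unit n k k\<close> is itself a map from
  \<open>R\<close> to matrices and can serve as a homomorphism.\<close>

definition mat_unit :: "nat \<Rightarrow> nat \<Rightarrow> nat \<Rightarrow> 'a \<Rightarrow> 'a mat" where
  "mat_unit n p q r = mat n n (\<lambda>(i, j). if i = p \<and> j = q then r else \<zero>)"

lemma mat_unit_closed: "r \<in> carrier R \<Longrightarrow> mat_unit n p q r \<in> carrier (matrix_ring n R)"
  by (simp add: mat_unit_def matrix_ring_sel)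

lemma mat_unit_mult_right:
  assumes A: "A \<in> carrier (matrix_ring n R)" and r: "r \<in> carrier R" and ij: "i < n" "j < n" "p < n"
  shows "(A \<otimes>\<^bsub>matrix_ring n R\<^esub> mat_unit n p q r) $$ (i, j) = (if j = q then A $$ (i, p) \<otimes> r else \<zero>)"
proof -
  have "(A \<otimes>\<^bsub>matrix_ring n R\<^esub> mat_unit n p q r) $$ (i, j)
    = (\<Oplus>k\<in>{..<n}. if k = p then (if j = q then A $$ (i, k) \<otimes> r else \<zero>) else \<zero>)"
    unfolding matrix_mult_entry[OF ij(1,2)] using assms
    by (intro finsum_cong') (auto simp: mat_unit_def matrix_entry)
  also have "\<dots> = (if j = q then A $$ (i, p) \<otimes> r else \<zero>)"
    using assms by (subst finsum_delta) (auto simp: matrix_entry)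
  finally show ?thesis .
qed

lemma mat_unit_sandwich:
  assumes A: "A \<in> carrier (matrix_ring n R)" and B: "B \<in> carrier (matrix_ring n R)"
    and r: "r \<in> carrier R" and ij: "i < n" "j < n" "p < n" "q < n"
  shows "(A \<otimes>\<^bsub>matrix_ring n R\<^esub> mat_unit n p q r \<otimes>\<^bsub>matrix_ring n R\<^esub> B) $$ (i, j)
    = A $$ (i, p) \<otimes> r \<otimes> B $$ (q, j)"
proof -
  have "(A \<otimes>\<^bsub>matrix_ring n R\<^esub> mat_unit n p q r \<otimes>\<^bsub>matrix_ring n R\<^esub> B) $$ (i, j)
    = (\<Oplus>k\<in>{..<n}. if k = q then A $$ (i, p) \<otimes> r \<otimes> B $$ (k, j) else \<zero>)"
    unfolding matrix_mult_entry[OF ij(1,2)] using assms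
    by (intro finsum_cong') (auto simp: mat_unit_mult_right matrix_entry)
  also have "\<dots> = A $$ (i, p) \<otimes> r \<otimes> B $$ (q, j)"
    using assms by (subst finsum_delta) (auto simp: matrix_entry)
  finally show ?thesis .
qed

end

section \<open>Primeness and diagonal corners of the matrix ring\<close>

lemma (in t_fine_ring) prime_matrix_ring: "prime_ring (matrix_ring n R)"
proof -
  interpret M: ring "matrix_ring n R" by (rule ring_matrix_ring)
  show ?thesis
  proof
    fix P Q
    assume P: "P \<in> carrier (matrix_ring n R)" and Q: "Q \<in> carrier (matrix_ring n R)"
      and Q0: "Q \<noteq> \<zero>\<^bsub>matrix_ring n R\<^esub>"
      and PQ: "\<And>S. S \<in> carrier (matrix_ring n R) \<Longrightarrow>
        P \<otimes>\<^bsub>matrix_ring n R\<^esub> S \<otimes>\<^bsub>matrix_ring n R\<^esub> Q = \<zero>\<^bsub>matrix_ring n R\<^esub>"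
    obtain k l where kl: "k < n" "l < n" "Q $$ (k, l) \<noteq> \<zero>"
      using Q0 matrix_eqI[OF Q M.zero_closed] by (auto simp: matrix_ring_sel)
    show "P = \<zero>\<^bsub>matrix_ring n R\<^esub>"
    proof (rule matrix_eqI[OF P M.zero_closed])
      fix i j assume ij: "i < n" "j < n"
      have "P $$ (i, j) = \<zero>"
      proof (rule prime[of _ "Q $$ (k, l)"])
        fix r assume r: "r \<in> carrier R"
        \<comment> \<open>Placing \<open>r\<close> at position \<open>(j, k)\<close> isolates a
          single product of entries, which reduces the claim to primeness of
          \<open>R\<close>.\<close>
        have "P $$ (i, j) \<otimes> r \<otimes> Q $$ (k, l)
          = (P \<otimes>\<^bsub>matrix_ring n R\<^esub> mat_unit n j k r \<otimes>\<^bsub>matrix_ring n R\<^esub> Q) $$ (i, l)"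
          using mat_unit_sandwich[OF P Q r] ij kl by simp
        also have "\<dots> = \<zero>" using PQ[OF mat_unit_closed[OF r]] ij kl by (simp add: matrix_ring_sel)
        finally show "P $$ (i, j) \<otimes> r \<otimes> Q $$ (k, l) = \<zero>" .
      qed (use P Q ij kl in \<open>auto simp: matrix_entry\<close>)
      then show "P $$ (i, j) = \<zero>\<^bsub>matrix_ring n R\<^esub> $$ (i, j)" using ij by (simp add: matrix_ring_sel)
    qed
  qed
qed

lemma (in ring) mat_unit_mult:
  assumes "r \<in> carrier R" "s \<in> carrier R" "k < n"
  shows "mat_unit n k k (r \<otimes> s) = mat_unit n k k r \<otimes>\<^bsub>matrix_ring n R\<^esub> mat_unit n k k s"
  by (rule matrix_eqI[where n=n])
    (use assms in \<open>auto simp: mat_unit_closed matrix_mult_closed mat_unit_mult_right\<close>,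
     use assms in \<open>auto simp: mat_unit_def\<close>)

text \<open>This corner is a copy of \<open>R\<close>: the map placing an element at position
  \<open>(k, k)\<close> is a homomorphism from \<open>R\<close> onto it.\<close>

lemma (in t_fine_ring) t_fine_corner_diag_proj:
  assumes k: "k < n"
  shows "t_fine_ring (corner (matrix_ring n R) (diag_proj n {k}))"
proof (rule t_fine_ring_hom_image[OF t_fine_ring_axioms])
  interpret M: ring "matrix_ring n R" by (rule ring_matrix_ring)
  let ?d = "diag_proj n {k}"
  have carr: "mat_unit n k k r \<in> peirce (matrix_ring n R) ?d ?d" if "r \<in> carrier R" for r
  proof -
    have "?d \<otimes>\<^bsub>matrix_ring n R\<^esub> mat_unit n k k r = mat_unit n k k r"
      "mat_unit n k k r \<otimes>\<^bsub>matrix_ring n R\<^esub> ?d = mat_unit n k k r"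
      using mat_unit_closed[OF that, of n k k]
      by (auto simp: matrix_mult_closed diag_proj_mult_left diag_proj_mult_right
          intro!: matrix_eqI[where n=n]) (simp_all add: mat_unit_def)
    then show ?thesis using that by (simp add: peirce_def mat_unit_closed)
  qed
  show "ring (corner (matrix_ring n R) ?d)"
    by (rule M.ring_corner) (simp_all add: diag_proj_mult)
  show "mat_unit n k k \<in> ring_hom R (corner (matrix_ring n R) ?d)"
  proof (rule ring_hom_memI)
    show "mat_unit n k k \<one> = \<one>\<^bsub>corner (matrix_ring n R) ?d\<^esub>"
      by (auto simp: mat_unit_def diag_proj_def intro!: eq_matI)
  qed (use carr k mat_unit_mult in \<open>auto simp: mat_unit_def matrix_ring_sel(3) intro!: eq_matI\<close>)
  show "mat_unit n k k ` carrier R = carrier (corner (matrix_ring n R) ?d)"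
  proof (intro equalityI subsetI)
    fix A assume "A \<in> carrier (corner (matrix_ring n R) ?d)"
    then have A: "A \<in> carrier (matrix_ring n R)" and dA: "?d \<otimes>\<^bsub>matrix_ring n R\<^esub> A = A"
      and Ad: "A \<otimes>\<^bsub>matrix_ring n R\<^esub> ?d = A" by (auto simp: peirce_def)
    have Akk: "A $$ (k, k) \<in> carrier R" using A k by (simp add: matrix_entry)
    have "A = mat_unit n k k (A $$ (k, k))"
    proof (rule matrix_eqI[OF A mat_unit_closed[OF Akk]])
      fix i j assume ij: "i < n" "j < n"
      \<comment> \<open>Multiplying by the projection on the left clears all rows but
        \<open>k\<close>, on the right all columns but \<open>k\<close>, while \<open>A\<close> is
        unchanged.\<close>
      show "A $$ (i, j) = mat_unit n k k (A $$ (k, k)) $$ (i, j)"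
        using diag_proj_mult_left[OF A ij, of "{k}"] diag_proj_mult_right[OF A ij, of "{k}"] ij
        by (auto simp: dA Ad mat_unit_def split: if_splits)
    qed
    then show "A \<in> mat_unit n k k ` carrier R" using Akk by blast
  qed (use carr in auto)
qed

theorem theorem5p3:
  fixes R :: "('a, 'm) ring_scheme" and n :: nat
  assumes "t_fine_ring R"
    and "n \<ge> 1"
  shows "t_fine_ring (matrix_ring n R)"
proof -
  interpret R: t_fine_ring R by fact
  interpret M: prime_ring "matrix_ring n R" by (rule R.prime_matrix_ring)
  \<comment> \<open>Generalised to all sets of positions; the full set gives the corner at the
    identity, which is the whole matrix ring.\<close>
  have "t_fine_ring (corner (matrix_ring n R) (R.diag_proj n I))" if "finite I" "I \<subseteq> {..<n}" for I
    using that
  proof (induction I rule: finite_induct)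
    case empty
    \<comment> \<open>The empty set gives the zero ring, which is t-fine vacuously.\<close>
    have "ring (corner (matrix_ring n R) \<zero>\<^bsub>matrix_ring n R\<^esub>)" by (rule M.ring_corner) simp_all
    then show ?case by (auto simp: t_fine_ring_iff peirce_def R.matrix_zero_eq[symmetric])
  next
    case (insert k I)
    have "t_fine_ring (corner (matrix_ring n R)
      (R.diag_proj n {k} \<oplus>\<^bsub>matrix_ring n R\<^esub> R.diag_proj n I))"
      using insert R.t_fine_corner_diag_proj
      by (intro M.t_fine_corner_add)
        (auto simp: R.diag_proj_mult R.matrix_zero_eq)
    then show ?case using insert by (simp add: R.diag_proj_add)
  qed
  from this[of "{..<n}"] show ?thesis
    by (simp add: R.matrix_one_eq[symmetric] M.corner_one)
qed

end
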